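(* Let $\rho>0$ and let $x\in\mathbb{R}^n_\downarrow$ not be a multiple of $e$. Put $\underline\alpha:=\left(\frac{\rho}{2}\|x\|_2^2+n\right)-\sqrt{\left(\frac{\rho}{2}\|x\|_2^2+n\right)^2-2\rho\|x\|_1^2}$. If $x_n>\frac{\underline\alpha}{\rho\|x\|_1}$, then the vector $w^\star:=\frac{\underline w}{\|\underline w\|_2}$ with $\underline w=x-\frac{\underline\alpha}{\rho\|x\|_1}e$ is the solution to the optimization problem $$\min\left\{\tfrac12 w^\top\left(2ee^\top-\rho xx^\top\right)w: w\in\mathbb{S}^{n-1}_+\right\}.$$ Furthermore, $\mathrm{prox}_{\frac1\rho h_2}(x)=\{\langle x,w^\star\rangle w^\star\}$.
   Context: $e\in\mathbb{R}^n$ is the all-ones vector. $\mathbb{R}^n_\downarrow=\{x\in\mathbb{R}^n:x_1\ge\dots\ge x_n\ge0\}$. $\mathbb{S}^{n-1}_+$ is the set of vectors in $\mathbb{R}^n$ of Euclidean norm $1$ with nonnegative entries. $h_2(u)=\left(\|u\|_1/\|u\|_2\right)^2$ for $u\ne0$ and $h_2(0)=0$. $\mathrm{prox}_{\frac1\rho h_2}(x)$ is the set of all minimizers over $u\in\mathbb{R}^n$ of $\frac{\rho}{2}\|u-x\|_2^2+h_2(u)$. *)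

theory Defs
  imports "HOL-Analysis.Analysis"
begin

text \<open>
  Coordinates of \<open>real ^ 'n\<close> are ordered through a finite linear order \<open>'n\<close>, which plays the
  role of \<open>{1, \<dots>, n}\<close> with \<open>n = CARD('n)\<close>; the last coordinate \<open>x\<^sub>n\<close> is \<open>x $ Max UNIV\<close>.
\<close>

definition all_ones :: "real ^ 'n"
  where "all_ones = (\<chi> i. 1)"

definition l1_norm :: "real ^ 'n \<Rightarrow> real"
  where "l1_norm x = (\<Sum>i\<in>UNIV. \<bar>x $ i\<bar>)"

definition outer :: "real ^ 'n \<Rightarrow> real ^ 'n \<Rightarrow> real ^ 'n ^ 'n"
  where "outer u v = (\<chi> i j. u $ i * v $ j)"

definition nonneg_nonincreasing :: "(real ^ 'n::{finite,linorder}) set"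
  where "nonneg_nonincreasing = {x. (\<forall>i j. i \<le> j \<longrightarrow> x $ j \<le> x $ i) \<and> (\<forall>i. 0 \<le> x $ i)}"

definition last_coord :: "real ^ 'n::{finite,linorder} \<Rightarrow> real"
  where "last_coord x = x $ Max UNIV"

definition nonneg_sphere :: "(real ^ 'n) set"
  where "nonneg_sphere = {w. norm w = 1 \<and> (\<forall>i. 0 \<le> w $ i)}"

definition minimizers :: "('a \<Rightarrow> real) \<Rightarrow> 'a set \<Rightarrow> 'a set"
  where "minimizers f S = {w. is_arg_min f (\<lambda>v. v \<in> S) w}"

definition h2 :: "real ^ 'n \<Rightarrow> real"
  where "h2 u = (if u = 0 then 0 else (l1_norm u / norm u)\<^sup>2)"

text \<open>\<open>prox \<rho> h x\<close> is the set-valued \<open>prox\<close> of \<open>(1/\<rho>) h\<close> at \<open>x\<close>.\<close>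

definition prox :: "real \<Rightarrow> (real ^ 'n \<Rightarrow> real) \<Rightarrow> real ^ 'n \<Rightarrow> (real ^ 'n) set"
  where "prox \<rho> h x = minimizers (\<lambda>u. \<rho> / 2 * (norm (u - x))\<^sup>2 + h u) UNIV"

end

theory Submission
  imports Defs
begin

text \<open>
  Write \<open>f v = \<langle>e, v\<rangle>\<^sup>2 - \<rho>/2 \<langle>x, v\<rangle>\<^sup>2\<close> for the quadratic form. The number \<open>t = \<alpha> / (\<rho> \<parallel>x\<parallel>\<^sub>1)\<close> is
  the smaller root of \<open>\<rho> \<parallel>x\<parallel>\<^sub>1 t\<^sup>2 - (\<rho> \<parallel>x\<parallel>\<^sup>2 + 2 n) t + 2 \<parallel>x\<parallel>\<^sub>1 = 0\<close>, which says exactly that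
  \<open>w = x - t e\<close> is an eigenvector; its eigenvalue \<open>-\<rho> \<langle>x, w\<rangle>\<close> is negative because \<open>x\<close> and \<open>w\<close> have
  positive entries. On the orthogonal complement of \<open>w\<close> one has \<open>\<langle>x, v\<rangle> = t \<langle>e, v\<rangle>\<close>, so
  \<open>f v = (1 - \<rho> t\<^sup>2 / 2) \<langle>e, v\<rangle>\<^sup>2\<close>, which is nonnegative because the two roots have product
  \<open>2 / \<rho>\<close>. Hence \<open>w\<close> spans the lowest eigenspace. For the proximal map, taking absolute values of
  the entries of \<open>u = r v\<close> can only decrease the objective, and minimizing over \<open>r\<close> first leaves
  \<open>f v + \<rho>/2 \<parallel>x\<parallel>\<^sup>2\<close>.
\<close>

lemma minimizers_eq_singleton_iff:
  "minimizers f S = {w} \<longleftrightarrow> w \<in> S \<and> (\<forall>v\<in>S. v \<noteq> w \<longrightarrow> f w < f v)"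
proof
  assume eq: "minimizers f S = {w}"
  then have w: "w \<in> S" "\<forall>v\<in>S. f w \<le> f v"
    by (auto simp: minimizers_def is_arg_min_linorder)
  have "f w < f v" if "v \<in> S" "v \<noteq> w" for v
  proof (rule ccontr)
    assume "\<not> f w < f v"
    then have "v \<in> minimizers f S"
      using w that by (force simp: minimizers_def is_arg_min_linorder)
    with eq that show False by simp
  qed
  with w show "w \<in> S \<and> (\<forall>v\<in>S. v \<noteq> w \<longrightarrow> f w < f v)" by blast
next
  assume "w \<in> S \<and> (\<forall>v\<in>S. v \<noteq> w \<longrightarrow> f w < f v)"
  then show "minimizers f S = {w}"
    by (force simp: minimizers_def is_arg_min_linorder)
qed

text \<open>Split \<open>v = a *\<^sub>R w + z\<close> with \<open>z\<close> orthogonal to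
  \<open>w\<close>. The form minus the claimed bound depends on \<open>z\<close> only and is a sum
  of two nonnegative terms. The second is a positive multiple of the squared norm of
  \<open>z\<close>, so equality forces \<open>z = 0\<close>.\<close>

lemma rank_two_form_lower_bound:
  fixes e x w v :: "'a::real_inner"
  assumes w: "w = x - t *\<^sub>R e" and ev: "\<rho> * t * (x \<bullet> w) = 2 * (e \<bullet> w)"
    and pos: "0 < \<rho> * (x \<bullet> w)" and t: "\<rho> * t\<^sup>2 \<le> 2"
  shows "- (\<rho> / 2 * (x \<bullet> w)) * (norm v)\<^sup>2 \<le> (e \<bullet> v)\<^sup>2 - \<rho> / 2 * (x \<bullet> v)\<^sup>2"
    and "(e \<bullet> v)\<^sup>2 - \<rho> / 2 * (x \<bullet> v)\<^sup>2 = - (\<rho> / 2 * (x \<bullet> w)) * (norm v)\<^sup>2 \<Longrightarrow> \<exists>a. v = a *\<^sub>R w"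
proof -
  have "w \<noteq> 0" using pos by auto
  define a where "a = (w \<bullet> v) / (w \<bullet> w)"
  define z where "z = v - a *\<^sub>R w"
  have v: "v = a *\<^sub>R w + z" by (simp add: z_def)
  have wz: "w \<bullet> z = 0" using \<open>w \<noteq> 0\<close> by (simp add: z_def a_def inner_diff_right)
  have x: "x = w + t *\<^sub>R e" using w by simp
  have xz: "x \<bullet> z = t * (e \<bullet> z)" using wz by (simp add: x inner_add_left)
  have ew: "e \<bullet> w = \<rho> * t * (x \<bullet> w) / 2" using ev by simp
  have ww: "w \<bullet> w = x \<bullet> w - t * (e \<bullet> w)"
    by (subst (1) w) (simp add: inner_diff_left)
  have nv: "(norm v)\<^sup>2 = a\<^sup>2 * (w \<bullet> w) + (norm z)\<^sup>2"
    unfolding power2_norm_eq_inner using wz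
    by (simp add: v inner_add_left inner_add_right inner_commute[of z w] power2_eq_square)
  \<comment> \<open>By \<open>ev\<close> and \<open>xz\<close> the cross terms between
    \<open>w\<close> and \<open>z\<close> cancel, and the terms in \<open>a\<^sup>2\<close> cancel
    against the added multiple of the squared norm.\<close>
  have eq: "(e \<bullet> v)\<^sup>2 - \<rho> / 2 * (x \<bullet> v)\<^sup>2 + \<rho> / 2 * (x \<bullet> w) * (norm v)\<^sup>2
      = (1 - \<rho> * t\<^sup>2 / 2) * (e \<bullet> z)\<^sup>2 + \<rho> / 2 * (x \<bullet> w) * (norm z)\<^sup>2"
    unfolding nv ww unfolding v inner_add_right inner_scaleR_right xz ew
    by (simp add: field_simps power2_eq_square)
  have n1: "0 \<le> (1 - \<rho> * t\<^sup>2 / 2) * (e \<bullet> z)\<^sup>2" using t by simp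
  have n2: "0 \<le> \<rho> / 2 * (x \<bullet> w) * (norm z)\<^sup>2" using pos by simp
  show "- (\<rho> / 2 * (x \<bullet> w)) * (norm v)\<^sup>2 \<le> (e \<bullet> v)\<^sup>2 - \<rho> / 2 * (x \<bullet> v)\<^sup>2"
    using eq n1 n2 unfolding mult_minus_left by linarith
  assume "(e \<bullet> v)\<^sup>2 - \<rho> / 2 * (x \<bullet> v)\<^sup>2 = - (\<rho> / 2 * (x \<bullet> w)) * (norm v)\<^sup>2"
  then have "\<rho> / 2 * (x \<bullet> w) * (norm z)\<^sup>2 = 0"
    using eq n1 n2 unfolding mult_minus_left by linarith
  then have "z = 0" using pos by (auto simp: mult_eq_0_iff)
  then show "\<exists>a. v = a *\<^sub>R w" using v by auto
qed

lemma l1_norm_nonneg_eq: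
  assumes "\<And>i. 0 \<le> v $ i"
  shows "l1_norm v = all_ones \<bullet> v"
  using assms by (simp add: l1_norm_def all_ones_def inner_vec_def)

lemma outer_vector_mult: "outer a b *v v = (b \<bullet> v) *\<^sub>R a"
  by (simp add: vec_eq_iff outer_def matrix_vector_mult_def inner_vec_def sum_distrib_left mult_ac)

lemma nonneg_sphere_abs:
  assumes "u \<noteq> 0"
  shows "(\<chi> i. \<bar>u $ i\<bar>) /\<^sub>R norm u \<in> nonneg_sphere"
proof -
  have "norm (\<chi> i. \<bar>u $ i\<bar>) = norm u" by (simp add: norm_vec_def)
  then show ?thesis using assms by (simp add: nonneg_sphere_def)
qed

text \<open>Since \<open>h2\<close> is unchanged by positive scaling and by sign changes of entries,
  a nonzero \<open>u\<close> is compared with \<open>r *\<^sub>R v\<close>, where \<open>r\<close>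
  is its norm and \<open>v\<close> lies in \<open>nonneg_sphere\<close>. For fixed \<open>v\<close>
  the best radius is \<open>x \<bullet> v\<close>, and what remains is the form plus a
  constant.\<close>

lemma prox_h2_eq:
  fixes x v0 :: "real ^ 'n"
  assumes \<rho>: "\<rho> > 0" and x: "\<And>i. 0 < x $ i"
    and min: "minimizers (\<lambda>v. (all_ones \<bullet> v)\<^sup>2 - \<rho> / 2 * (x \<bullet> v)\<^sup>2) nonneg_sphere = {v0}"
    and neg: "(all_ones \<bullet> v0)\<^sup>2 - \<rho> / 2 * (x \<bullet> v0)\<^sup>2 < 0"
  shows "prox \<rho> h2 x = {(x \<bullet> v0) *\<^sub>R v0}"
proof -
  define f where "f = (\<lambda>v. (all_ones \<bullet> v)\<^sup>2 - \<rho> / 2 * (x \<bullet> v)\<^sup>2)"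
  define g where "g = (\<lambda>u. \<rho> / 2 * (norm (u - x))\<^sup>2 + h2 u)"
  define c where "c = x \<bullet> v0"
  have v0: "norm v0 = 1" "\<And>i. 0 \<le> v0 $ i"
    and less: "\<And>v. v \<in> nonneg_sphere \<Longrightarrow> v \<noteq> v0 \<Longrightarrow> f v0 < f v"
    using min by (auto simp: minimizers_eq_singleton_iff nonneg_sphere_def f_def)
  have "0 \<le> c" unfolding c_def inner_vec_def
    using x v0 by (auto intro!: sum_nonneg simp: less_imp_le)
  \<comment> \<open>If \<open>c\<close> were zero, the form at \<open>v0\<close> would be a square,
    against \<open>neg\<close>.\<close>
  moreover have "c \<noteq> 0" using neg by (auto simp: c_def)
  ultimately have c: "0 < c" by simp
  have g_expand: "g u = \<rho> / 2 * (norm u)\<^sup>2 - \<rho> * (x \<bullet> u) + \<rho> / 2 * (norm x)\<^sup>2 + h2 u" for u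
    by (simp add: g_def power2_norm_eq_inner inner_diff_left inner_diff_right inner_commute field_simps)
  have "v0 \<noteq> 0" using v0 by auto
  have "l1_norm (c *\<^sub>R v0) = c * (all_ones \<bullet> v0)"
    using c v0 by (subst l1_norm_nonneg_eq) auto
  then have "h2 (c *\<^sub>R v0) = (all_ones \<bullet> v0)\<^sup>2"
    using c v0 \<open>v0 \<noteq> 0\<close> by (simp add: h2_def)
  then have g0: "g (c *\<^sub>R v0) = f v0 + \<rho> / 2 * (norm x)\<^sup>2"
    using v0 by (simp add: g_expand f_def c_def power2_eq_square field_simps)
  have "g (c *\<^sub>R v0) < g u" if u: "u \<noteq> c *\<^sub>R v0" for u
  proof (cases "u = 0")
    \<comment> \<open>At the origin the objective is the constant alone, and \<open>neg\<close> puts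
      \<open>v0\<close> strictly below it.\<close>
    case True
    then show ?thesis using neg by (simp add: g0) (simp add: g_def h2_def f_def)
  next
    case False
    define r where "r = norm u"
    define v where "v = (\<chi> i. \<bar>u $ i\<bar>) /\<^sub>R r"
    have r: "0 < r" using False by (simp add: r_def)
    have v: "v \<in> nonneg_sphere" using nonneg_sphere_abs[OF False] by (simp add: v_def r_def)
    have rv: "r *\<^sub>R v = (\<chi> i. \<bar>u $ i\<bar>)" using r by (simp add: v_def)
    have "l1_norm u = all_ones \<bullet> (r *\<^sub>R v)"
      unfolding rv by (simp add: l1_norm_def all_ones_def inner_vec_def)
    then have h: "h2 u = (all_ones \<bullet> v)\<^sup>2"
      using False r by (simp add: h2_def r_def)
    have xu: "x \<bullet> u = x \<bullet> (r *\<^sub>R v) - (\<Sum>i\<in>UNIV. x $ i * (\<bar>u $ i\<bar> - u $ i))"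
      unfolding rv by (simp add: inner_vec_def sum_subtractf[symmetric] algebra_simps)
    \<comment> \<open>Completing the square in \<open>r\<close> isolates the excess due to a wrong
      radius; the last sum is the excess due to negative entries of \<open>u\<close>.\<close>
    have gu: "g u = f v + \<rho> / 2 * (norm x)\<^sup>2 + \<rho> / 2 * (r - x \<bullet> v)\<^sup>2
        + \<rho> * (\<Sum>i\<in>UNIV. x $ i * (\<bar>u $ i\<bar> - u $ i))"
      unfolding g_expand h xu r_def[symmetric] f_def by (simp add: power2_eq_square algebra_simps)
    have n1: "0 \<le> \<rho> / 2 * (r - x \<bullet> v)\<^sup>2" using \<rho> by simp
    have term_nonneg: "0 \<le> x $ i * (\<bar>u $ i\<bar> - u $ i)" for i using x[of i] by simp
    have n2: "0 \<le> \<rho> * (\<Sum>i\<in>UNIV. x $ i * (\<bar>u $ i\<bar> - u $ i))"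
      using \<rho> term_nonneg by (simp add: sum_nonneg)
    show ?thesis
    proof (rule ccontr)
      assume not_less: "\<not> ?thesis"
      \<comment> \<open>If \<open>u\<close> does no worse than the candidate, all three excesses
        vanish: direction, radius and sign. Positive entries of \<open>x\<close> make the last one
        force \<open>u\<close> to be nonnegative.\<close>
      then have "v = v0" using less[OF v] g0 gu n1 n2 by (cases "v = v0") auto
      then have "\<rho> / 2 * (r - x \<bullet> v)\<^sup>2 = 0"
        and "\<rho> * (\<Sum>i\<in>UNIV. x $ i * (\<bar>u $ i\<bar> - u $ i)) = 0"
        using not_less g0 gu n1 n2 by (simp_all only:)
      then have rc: "r = c" and "(\<Sum>i\<in>UNIV. x $ i * (\<bar>u $ i\<bar> - u $ i)) = 0"
        using \<rho> \<open>v = v0\<close> by (auto simp: c_def)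
      then have "\<forall>i. x $ i * (\<bar>u $ i\<bar> - u $ i) = 0"
        using term_nonneg by (simp add: sum_nonneg_eq_0_iff)
      then have "\<forall>i. \<bar>u $ i\<bar> = u $ i" using x by (metis eq_iff_diff_eq_0 mult_eq_0_iff less_irrefl)
      then have "u = r *\<^sub>R v" unfolding rv by (simp add: vec_eq_iff)
      with u rc \<open>v = v0\<close> show False by simp
    qed
  qed
  then show ?thesis
    unfolding prox_def g_def[symmetric] c_def[symmetric] by (simp add: minimizers_eq_singleton_iff)
qed

text \<open>The roots of \<open>z\<^sup>2 - 2 * A * z + P\<close> are nonnegative with product
  \<open>P\<close>, so the square of the smaller one is at most \<open>P\<close>.\<close>

lemma smaller_root:
  fixes A P :: real
  assumes \<alpha>: "\<alpha> = A - sqrt (A\<^sup>2 - P)" and "0 \<le> A" "0 \<le> P" "P \<le> A\<^sup>2"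
  shows "0 \<le> \<alpha>" "\<alpha>\<^sup>2 + P = 2 * A * \<alpha>" "\<alpha>\<^sup>2 \<le> P"
proof -
  define s where "s = sqrt (A\<^sup>2 - P)"
  have s: "0 \<le> s" "s\<^sup>2 = A\<^sup>2 - P" using assms by (simp_all add: s_def)
  have sA: "s \<le> A" using s assms(2,3) by (auto intro!: power2_le_imp_le[of s A])
  then show "0 \<le> \<alpha>" by (simp add: \<alpha> s_def)
  show "\<alpha>\<^sup>2 + P = 2 * A * \<alpha>"
    using s(2) unfolding \<alpha> s_def[symmetric] by (simp add: power2_eq_square algebra_simps)
  have "s * s \<le> s * A" using s sA by (intro mult_left_mono)
  then show "\<alpha>\<^sup>2 \<le> P"
    using s(2) unfolding \<alpha> s_def[symmetric] by (simp add: power2_eq_square algebra_simps)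
qed

theorem theorem3p6:
  fixes \<rho> \<alpha> :: real
    and x w wstar :: "real ^ 'n::{finite,linorder}"
  assumes "\<rho> > 0"
    and "x \<in> nonneg_nonincreasing"
    and "\<nexists>c. x = c *\<^sub>R all_ones"
    and "\<alpha> = (\<rho> / 2 * (norm x)\<^sup>2 + real CARD('n))
           - sqrt ((\<rho> / 2 * (norm x)\<^sup>2 + real CARD('n))\<^sup>2 - 2 * \<rho> * (l1_norm x)\<^sup>2)"
    and "last_coord x > \<alpha> / (\<rho> * l1_norm x)"
    and "w = x - (\<alpha> / (\<rho> * l1_norm x)) *\<^sub>R all_ones"
    and "wstar = w /\<^sub>R norm w"
  shows "minimizers
           (\<lambda>v. 1 / 2 * (v \<bullet> ((2 *\<^sub>R outer all_ones all_ones - \<rho> *\<^sub>R outer x x) *v v)))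
           nonneg_sphere = {wstar}
         \<and> prox \<rho> h2 x = {(x \<bullet> wstar) *\<^sub>R wstar}"
proof -
  define S where "S = l1_norm x"
  define N where "N = (norm x)\<^sup>2"
  define n where "n = real CARD('n)"
  define A where "A = \<rho> / 2 * N + n"
  define t where "t = \<alpha> / (\<rho> * S)"
  have \<rho>: "\<rho> > 0" by fact
  have x_mono: "\<And>i j. i \<le> j \<Longrightarrow> x $ j \<le> x $ i" and x_nonneg: "\<And>i. 0 \<le> x $ i"
    using assms(2) by (auto simp: nonneg_nonincreasing_def)
  have S: "S = all_ones \<bullet> x" unfolding S_def by (intro l1_norm_nonneg_eq x_nonneg)
  have "x \<noteq> 0" using assms(3) by (metis scaleR_zero_left)
  then obtain k where "x $ k \<noteq> 0" by (auto simp: vec_eq_iff)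
  then have "0 < S" unfolding S_def l1_norm_def by (intro sum_pos2[of _ k]) auto
  have ee: "all_ones \<bullet> (all_ones :: real ^ 'n::{finite,linorder}) = n"
    by (simp add: all_ones_def inner_vec_def n_def)
  have CS: "S\<^sup>2 \<le> n * N"
    using Cauchy_Schwarz_ineq[of "all_ones :: real ^ 'n::{finite,linorder}" x]
    by (simp add: S ee N_def power2_norm_eq_inner)
  have "0 \<le> N" "0 < n" by (simp_all add: N_def n_def)
  \<comment> \<open>The square root has a nonnegative argument: after Cauchy-Schwarz, the gap to
    \<open>A\<^sup>2\<close> is itself a square.\<close>
  have disc: "2 * \<rho> * S\<^sup>2 \<le> A\<^sup>2"
  proof -
    have "2 * \<rho> * S\<^sup>2 \<le> 2 * \<rho> * (n * N)" using CS \<rho> by simp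
    also have "\<dots> = A\<^sup>2 - (\<rho> / 2 * N - n)\<^sup>2"
      by (simp add: A_def power2_eq_square field_simps)
    also have "\<dots> \<le> A\<^sup>2" by simp
    finally show ?thesis .
  qed
  have "\<alpha> = A - sqrt (A\<^sup>2 - 2 * \<rho> * S\<^sup>2)"
    using assms(4) by (simp add: A_def N_def n_def S_def)
  then have \<alpha>: "0 \<le> \<alpha>" "\<alpha>\<^sup>2 + 2 * \<rho> * S\<^sup>2 = 2 * A * \<alpha>" "\<alpha>\<^sup>2 \<le> 2 * \<rho> * S\<^sup>2"
    using smaller_root[of \<alpha> A "2 * \<rho> * S\<^sup>2"] disc \<rho> \<open>0 \<le> N\<close> \<open>0 < n\<close> by (auto simp: A_def)
  have \<alpha>_eq: "\<alpha> = \<rho> * S * t" using \<rho> \<open>0 < S\<close> by (simp add: t_def)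
  have "0 \<le> t" using \<alpha>(1) \<rho> \<open>0 < S\<close> by (simp add: t_def)
  have "\<rho> * S\<^sup>2 * (\<rho> * t\<^sup>2) \<le> \<rho> * S\<^sup>2 * 2"
    using \<alpha>(3) by (simp add: \<alpha>_eq power2_eq_square mult_ac)
  then have t2: "\<rho> * t\<^sup>2 \<le> 2" using \<rho> \<open>0 < S\<close> by simp
  have "\<rho> * S * (\<rho> * S * t\<^sup>2 + 2 * S) = \<rho> * S * (2 * A * t)"
    using \<alpha>(2) by (simp add: \<alpha>_eq power2_eq_square algebra_simps)
  then have root: "\<rho> * S * t\<^sup>2 + 2 * S = 2 * A * t" using \<rho> \<open>0 < S\<close> by simp
  have w: "w = x - t *\<^sub>R all_ones" using assms(6) by (simp add: t_def S_def)
  \<comment> \<open>The last coordinate is the smallest, so the bound on it passes to all of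
    them.\<close>
  have "t < x $ i" for i
    using assms(5) x_mono[of i "Max UNIV"] by (simp add: t_def S_def last_coord_def)
  then have w_pos: "0 < w $ i" and x_pos: "0 < x $ i" for i
    using \<open>0 \<le> t\<close> by (auto simp: w all_ones_def intro: le_less_trans)
  have xw_pos: "0 < x \<bullet> w"
    unfolding inner_vec_def using x_pos w_pos by (auto intro!: sum_pos)
  have xw: "x \<bullet> w = N - t * S"
    by (simp add: w inner_diff_right N_def S power2_norm_eq_inner inner_commute)
  have ew: "all_ones \<bullet> w = S - t * n"
    by (simp add: w inner_diff_right S ee)
  have eigen: "\<rho> * t * (x \<bullet> w) = 2 * (all_ones \<bullet> w)"
    using root unfolding xw ew by (simp add: A_def power2_eq_square algebra_simps)
  have "w \<noteq> 0" using xw_pos by auto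
  define f where "f = (\<lambda>v. (all_ones \<bullet> v)\<^sup>2 - \<rho> / 2 * (x \<bullet> v)\<^sup>2)"
  note lower = rank_two_form_lower_bound[OF w eigen _ t2]
  have \<mu>: "0 < \<rho> * (x \<bullet> w)" using \<rho> xw_pos by simp
  have wstar: "wstar \<in> nonneg_sphere"
    using \<open>w \<noteq> 0\<close> w_pos by (auto simp: assms(7) nonneg_sphere_def less_imp_le)
  have ww: "(norm w)\<^sup>2 = x \<bullet> w - t * (all_ones \<bullet> w)"
    by (subst (1) w) (simp add: power2_norm_eq_inner w inner_diff_left inner_diff_right inner_commute algebra_simps)
  have "f w = - (\<rho> / 2 * (x \<bullet> w)) * (norm w)\<^sup>2"
  proof -
    have "all_ones \<bullet> w = \<rho> * t * (x \<bullet> w) / 2" using eigen by simp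
    then show ?thesis unfolding f_def ww by (simp add: power2_eq_square field_simps)
  qed
  moreover have "f wstar = (inverse (norm w))\<^sup>2 * f w"
    unfolding f_def assms(7) inner_scaleR_right power_mult_distrib by (simp only: algebra_simps)
  ultimately have f_wstar: "f wstar = - (\<rho> / 2 * (x \<bullet> w))"
    using \<open>w \<noteq> 0\<close> by (simp add: power_inverse)
  \<comment> \<open>A competing minimizer attains the lower bound, hence is a multiple of
    \<open>w\<close>; nonnegative entries and unit norm then fix the factor.\<close>
  have "f wstar < f v" if v: "v \<in> nonneg_sphere" "v \<noteq> wstar" for v
  proof (rule ccontr)
    assume "\<not> f wstar < f v"
    moreover have nv: "norm v = 1" and v_nonneg: "\<And>i. 0 \<le> v $ i"
      using v(1) by (auto simp: nonneg_sphere_def)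
    ultimately have "f v = - (\<rho> / 2 * (x \<bullet> w)) * (norm v)\<^sup>2"
      using lower(1)[OF \<mu>, of v] f_wstar by (simp add: f_def)
    then obtain a where a: "v = a *\<^sub>R w"
      using lower(2)[OF \<mu>, of v] by (auto simp: f_def)
    have "0 \<le> a" using v_nonneg[of k] w_pos[of k] by (simp add: a zero_le_mult_iff)
    then have "a = 1 / norm w" using nv \<open>w \<noteq> 0\<close> by (simp add: a field_simps)
    then have "v = wstar" by (simp add: a assms(7) inverse_eq_divide)
    with v(2) show False by simp
  qed
  then have min: "minimizers f nonneg_sphere = {wstar}"
    using wstar by (simp add: minimizers_eq_singleton_iff)
  have "f wstar < 0" using f_wstar \<mu> by simp
  then have "prox \<rho> h2 x = {(x \<bullet> wstar) *\<^sub>R wstar}"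
    using prox_h2_eq[OF \<rho> x_pos] min by (simp add: f_def)
  moreover have "(\<lambda>v. 1 / 2 * (v \<bullet> ((2 *\<^sub>R outer all_ones all_ones - \<rho> *\<^sub>R outer x x) *v v))) = f"
    by (simp add: fun_eq_iff f_def matrix_vector_mult_diff_rdistrib scaleR_matrix_vector_assoc[symmetric]
        outer_vector_mult inner_diff_right inner_commute power2_eq_square field_simps)
  ultimately show ?thesis using min by simp
qed

end
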